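(* For any non-decreasing function $h$, the functional $$\boldsymbol{P}\mapsto\phi_h(\boldsymbol{P}):=\mathbb{E}_{1,\boldsymbol{P}}\,e^{-h(Y^{\mathrm{gum}})}$$ is convex in $\boldsymbol{P}\in\mathrm{Simp}(\mathcal{W})$.
   Context: $\mathcal{W}$ is a finite vocabulary and $\mathrm{Simp}(\mathcal{W})$ is the simplex of all probability vectors $\boldsymbol{P}=(P_w)_{w\in\mathcal{W}}$. For the Gumbel-max watermark, under $H_1$ with NTP distribution $\boldsymbol{P}$ the pivotal statistic $Y^{\mathrm{gum}}\in(0,1]$ has CDF $F_{1,\boldsymbol{P}}(r)=\sum_{w\in\mathcal{W}}P_wr^{1/P_w}$, $r\in[0,1]$ (terms with $P_w=0$ are $0$); $\mathbb{E}_{1,\boldsymbol{P}}$ is the expectation under this law. Here $h$ is a real-valued function on $(0,1]$ (its value at $0$ is irrelevant), and $\phi_h$ takes values in $(0,+\infty]$. *)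

theory Defs
  imports "HOL-Probability.Probability"
begin

text \<open>The vocabulary is a finite type; an NTP distribution is a probability vector indexed by it.\<close>

definition Simp :: "(real ^ 'w) set" where
  "Simp = {P. (\<forall>w. 0 \<le> P $ w) \<and> (\<Sum>w\<in>UNIV. P $ w) = 1}"

text \<open>The CDF of the pivotal statistic under the alternative, extended from \<open>[0,1]\<close> to the
  real line. Summands with \<open>P $ w = 0\<close> vanish, since \<open>1 / 0 = 0\<close> and the factor \<open>P $ w\<close> is zero;
  at \<open>r = 0\<close> every summand vanishes, since \<open>0 powr a = 0\<close>.\<close>

definition gumbel_cdf :: "real ^ 'w \<Rightarrow> real \<Rightarrow> real" where
  "gumbel_cdf P r =
     (if r < 0 then 0
      else if r \<le> 1 then (\<Sum>w\<in>UNIV. P $ w * r powr (1 / P $ w))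
      else 1)"

definition gumbel_law :: "real ^ 'w \<Rightarrow> real measure" where
  "gumbel_law P = interval_measure (gumbel_cdf P)"

lemma gumbel_cdf_clip:
  assumes "P \<in> Simp"
  shows "gumbel_cdf P r = (\<Sum>w\<in>UNIV. P $ w * (max 0 (min 1 r)) powr (1 / P $ w))"
  using assms by (auto simp: gumbel_cdf_def Simp_def max_def min_def)

lemma continuous_on_gumbel_cdf:
  assumes "P \<in> Simp"
  shows "continuous_on UNIV (gumbel_cdf P)"
proof -
  have "continuous_on UNIV (\<lambda>r. P $ w * (max 0 (min 1 r)) powr (1 / P $ w))" for w
  proof (cases "P $ w = 0")
    case False
    then have "P $ w > 0"
      using assms by (auto simp: Simp_def less_le)
    then show ?thesis
      by (intro continuous_intros continuous_on_powr') auto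
  qed simp
  then have "continuous_on UNIV (\<lambda>r. \<Sum>w\<in>UNIV. P $ w * (max 0 (min 1 r)) powr (1 / P $ w))"
    by (intro continuous_on_sum)
  then show ?thesis
    using gumbel_cdf_clip[OF assms] by (simp cong: continuous_on_cong)
qed

lemma mono_gumbel_cdf:
  assumes "P \<in> Simp" "r \<le> s"
  shows "gumbel_cdf P r \<le> gumbel_cdf P s"
  unfolding gumbel_cdf_clip[OF assms(1)] using assms
  by (intro sum_mono mult_left_mono powr_mono2) (auto simp: Simp_def)

lemma
  assumes "P \<in> Simp"
  shows real_distribution_gumbel_law: "real_distribution (gumbel_law P)"
    and cdf_gumbel_law: "cdf (gumbel_law P) = gumbel_cdf P"
proof -
  have cont: "continuous (at_right a) (gumbel_cdf P)" for a
    using continuous_on_gumbel_cdf[OF assms]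
    by (simp add: continuous_on_eq_continuous_at continuous_at_imp_continuous_within)
  have "eventually (\<lambda>r. gumbel_cdf P r = 0) at_bot"
    unfolding eventually_at_bot_linorder by (intro exI[of _ "-1"]) (simp add: gumbel_cdf_def)
  then have bot: "(gumbel_cdf P \<longlongrightarrow> 0) at_bot"
    by (rule tendsto_eventually)
  have "eventually (\<lambda>r. gumbel_cdf P r = 1) at_top"
    unfolding eventually_at_top_linorder by (intro exI[of _ 2]) (simp add: gumbel_cdf_def)
  then have top: "(gumbel_cdf P \<longlongrightarrow> 1) at_top"
    by (rule tendsto_eventually)
  show "real_distribution (gumbel_law P)"
    unfolding gumbel_law_def
    by (intro real_distribution_interval_measure mono_gumbel_cdf[OF assms] cont bot top)
  show "cdf (gumbel_law P) = gumbel_cdf P"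
    unfolding gumbel_law_def
    by (intro cdf_interval_measure mono_gumbel_cdf[OF assms] cont bot top)
qed

lemma AE_gumbel_law:
  assumes "P \<in> Simp"
  shows "AE y in gumbel_law P. y \<in> {0<..1}"
proof -
  interpret real_distribution "gumbel_law P"
    by (rule real_distribution_gumbel_law[OF assms])
  have "measure (gumbel_law P) {0<..1} = gumbel_cdf P 1 - gumbel_cdf P 0"
    using cdf_diff_eq[of 0 1] by (simp add: cdf_gumbel_law[OF assms])
  also have "\<dots> = 1"
    using assms by (auto simp: gumbel_cdf_def Simp_def)
  finally show ?thesis
    by (intro AE_prob_1) 
qed

text \<open>The expectation may be infinite, hence the value in \<^typ>\<open>ennreal\<close>. The
  law is concentrated on \<open>{0<..1}\<close>, so the values of \<open>h\<close> outside this interval are irrelevant.\<close>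

definition phi :: "(real \<Rightarrow> real) \<Rightarrow> real ^ 'w \<Rightarrow> ennreal" where
  "phi h P = (\<integral>\<^sup>+ y. ennreal (exp (- h y)) \<partial>gumbel_law P)"

text \<open>The analogue of \<^const>\<open>convex_on\<close> for functions with values in \<open>[0,\<infinity>]\<close>;
  in \<^typ>\<open>ennreal\<close>, \<open>0 * \<infinity> = 0\<close>.\<close>

definition convex_on_ennreal :: "'a::real_vector set \<Rightarrow> ('a \<Rightarrow> ennreal) \<Rightarrow> bool" where
  "convex_on_ennreal S f \<longleftrightarrow> convex S \<and>
     (\<forall>x\<in>S. \<forall>y\<in>S. \<forall>u\<ge>0. \<forall>v\<ge>0. u + v = 1 \<longrightarrow>
        f (u *\<^sub>R x + v *\<^sub>R y) \<le> ennreal u * f x + ennreal v * f y)"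

end

theory Submission
  imports Defs
begin

text \<open>By the layer cake formula, \<open>phi h P\<close> is an integral over \<open>t \<ge> 0\<close> of the probability of
  \<open>{y. t < exp (- h y)}\<close>. As \<open>h\<close> is non-decreasing, this set is an initial segment of \<open>{0<..1}\<close>, and
  the law has no atoms, so its probability is the value of the CDF at a point \<open>c\<close> not depending on \<open>P\<close>.
  It remains to see that the CDF at a fixed point is convex in \<open>P\<close>, and this holds summand by
  summand: \<open>p * r powr (1 / p)\<close> is the perspective of the convex function \<open>r powr x\<close>.\<close>

text \<open>For \<open>r\<close> nonzero, \<open>r powr x\<close> is the exponential of the linear
  function \<open>x * ln r\<close>; at \<open>r = 0\<close> both sides vanish.\<close>

lemma powr_convex_exponent:
  fixes r a b x y :: real
  assumes "0 \<le> a" "0 \<le> b" "a + b = 1"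
  shows "r powr (a * x + b * y) \<le> a * r powr x + b * r powr y"
proof (cases "r = 0")
  case False
  have "exp (a *\<^sub>R (x * ln r) + b *\<^sub>R (y * ln r)) \<le> a * exp (x * ln r) + b * exp (y * ln r)"
    using exp_convex assms unfolding convex_on_def by blast
  then show ?thesis
    using False by (simp add: powr_def algebra_simps)
qed simp

lemma convex_mult_powr_inverse:
  fixes r p q u v :: real
  assumes r: "0 \<le> r" "r \<le> 1" and nonneg: "0 \<le> p" "0 \<le> q" "0 \<le> u" "0 \<le> v" and "u + v = 1"
  shows "(u * p + v * q) * r powr (1 / (u * p + v * q))
    \<le> u * (p * r powr (1 / p)) + v * (q * r powr (1 / q))"
proof (cases "u * p + v * q = 0")
  case True
  then show ?thesis
    using nonneg by simp
next
  case False
  define m where "m = u * p + v * q"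
  have m: "0 < m"
    using False nonneg unfolding m_def by (simp add: less_le)
  \<comment> \<open>Convex weights whose average of \<open>1 / p\<close> and \<open>1 / q\<close> is
    \<open>1 / m\<close> when \<open>p\<close> and \<open>q\<close> are positive; multiplying by
    \<open>m\<close> turns them back into \<open>u * p\<close> and \<open>v * q\<close>.\<close>
  define a b where "a = u * p / m" and "b = v * q / m"
  have ab: "0 \<le> a" "0 \<le> b" "a + b = 1"
    using m nonneg by (auto simp: a_def b_def simp flip: add_divide_distrib m_def)
  \<comment> \<open>Only an inequality: for \<open>p = 0\<close> the left side is 0, while
    \<open>u / m\<close> may be positive.\<close>
  have "a * (1 / p) \<le> u / m"
    using m nonneg by (cases "p = 0") (simp_all add: a_def)
  moreover have "b * (1 / q) \<le> v / m"
    using m nonneg by (cases "q = 0") (simp_all add: b_def)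
  ultimately have "a * (1 / p) + b * (1 / q) \<le> u / m + v / m"
    by (rule add_mono)
  also have "\<dots> = 1 / m"
    using \<open>u + v = 1\<close> by (simp flip: add_divide_distrib)
  \<comment> \<open>As \<open>r\<close> lies in \<open>[0, 1]\<close>, the larger exponent gives the
    smaller power.\<close>
  finally have "r powr (1 / m) \<le> r powr (a * (1 / p) + b * (1 / q))"
    using r by (cases "r = 0") (auto intro: powr_mono')
  also have "\<dots> \<le> a * r powr (1 / p) + b * r powr (1 / q)"
    using ab by (rule powr_convex_exponent)
  finally have "m * r powr (1 / m) \<le> m * (a * r powr (1 / p) + b * r powr (1 / q))"
    using m by simp
  also have "\<dots> = u * (p * r powr (1 / p)) + v * (q * r powr (1 / q))"
    using m by (simp add: a_def b_def field_simps)
  finally show ?thesis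
    by (simp add: m_def)
qed

lemma convex_Simp: "convex (Simp :: (real ^ 'w) set)"
  by (rule convexI) (auto simp: Simp_def sum.distrib simp flip: sum_distrib_left)

text \<open>In the form \<open>gumbel_cdf_clip\<close> the base lies in \<open>[0, 1]\<close> for
  every real \<open>r\<close>, so \<open>convex_mult_powr_inverse\<close> applies to each
  summand.\<close>

lemma gumbel_cdf_convex:
  fixes P Q :: "real ^ 'w"
  assumes "P \<in> Simp" "Q \<in> Simp" "0 \<le> u" "0 \<le> v" "u + v = 1"
  shows "gumbel_cdf (u *\<^sub>R P + v *\<^sub>R Q) r \<le> u * gumbel_cdf P r + v * gumbel_cdf Q r"
proof -
  have "u *\<^sub>R P + v *\<^sub>R Q \<in> Simp"
    using convex_Simp assms by (rule convexD)
  then show ?thesis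
    using assms
    by (auto simp: gumbel_cdf_clip sum_distrib_left Simp_def simp flip: sum.distrib
        intro!: sum_mono convex_mult_powr_inverse)
qed

text \<open>Up to null sets, \<open>S\<close> is \<open>{..Sup S}\<close>: continuity of the CDF
  makes the endpoint null, so it does not matter whether \<open>Sup S\<close> belongs to
  \<open>S\<close>.\<close>

lemma emeasure_gumbel_law_initial_segment:
  assumes P: "P \<in> Simp" and S: "S \<in> sets borel" "S \<subseteq> {0<..1}" "S \<noteq> {}"
    and down: "\<And>x y. x \<in> S \<Longrightarrow> 0 < y \<Longrightarrow> y \<le> x \<Longrightarrow> y \<in> S"
  shows "emeasure (gumbel_law P) S = gumbel_cdf P (Sup S)"
proof -
  interpret real_distribution "gumbel_law P"
    by (rule real_distribution_gumbel_law[OF P])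
  have bdd: "bdd_above S"
    using S(2) by (intro bdd_aboveI[of _ 1]) auto
  have "isCont (gumbel_cdf P) (Sup S)"
    using continuous_on_gumbel_cdf[OF P] by (simp add: continuous_on_eq_continuous_at)
  then have "measure (gumbel_law P) {Sup S} = 0"
    by (simp add: isCont_cdf flip: cdf_gumbel_law[OF P])
  then have "AE y in gumbel_law P. y \<noteq> Sup S"
    by (intro AE_I[where N="{Sup S}"]) (auto simp: emeasure_eq_measure)
  \<comment> \<open>A positive \<open>y\<close> below \<open>Sup S\<close> lies below some element
    of \<open>S\<close>, hence in \<open>S\<close> by \<open>down\<close>.\<close>
  with AE_gumbel_law[OF P] have "AE y in gumbel_law P. y \<in> S \<longleftrightarrow> y \<in> {..Sup S}"
  proof eventually_elim
    case (elim y)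
    then show ?case
      using cSup_upper[OF _ bdd] less_cSupD[OF S(3), of y] down
      by (auto simp: less_le)
  qed
  then have "emeasure (gumbel_law P) S = emeasure (gumbel_law P) {..Sup S}"
    using S(1) by (intro emeasure_eq_AE) auto
  then show ?thesis
    by (simp add: emeasure_eq_measure cdf_def flip: cdf_gumbel_law[OF P])
qed

text \<open>Write \<open>g y\<close> as the length of \<open>{0..<g y}\<close> and exchange the two
  integrals by Tonelli.\<close>

lemma
  fixes g :: "'a \<Rightarrow> real"
  assumes "sigma_finite_measure M" and [measurable]: "g \<in> borel_measurable M"
  shows nn_integral_layer_cake:
      "(\<integral>\<^sup>+y. ennreal (g y) \<partial>M) = (\<integral>\<^sup>+t\<in>{0..}. emeasure M {y\<in>space M. t < g y} \<partial>lborel)"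
    and borel_measurable_emeasure_superlevel:
      "(\<lambda>t. emeasure M {y\<in>space M. t < g y}) \<in> borel_measurable borel"
proof -
  interpret sigma_finite_measure M by fact
  have level: "(\<integral>\<^sup>+y. indicator {y\<in>space M. t < g y} y \<partial>M) = emeasure M {y\<in>space M. t < g y}" for t
    by (rule nn_integral_indicator) measurable
  have "(\<lambda>(t, y). indicator {y\<in>space M. t < g y} y :: ennreal) \<in> borel_measurable (borel \<Otimes>\<^sub>M M)"
    by measurable
  from borel_measurable_nn_integral[OF this]
  show meas: "(\<lambda>t. emeasure M {y\<in>space M. t < g y}) \<in> borel_measurable borel"
    by (simp add: level)
  interpret pair_sigma_finite lborel M ..
  have "ennreal (g y) = (\<integral>\<^sup>+t. indicator {0..} t * indicator {y\<in>space M. t < g y} y \<partial>lborel)"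
    if "y \<in> space M" for y
  proof -
    have "(\<integral>\<^sup>+t. indicator {0..} t * indicator {y\<in>space M. t < g y} y \<partial>lborel)
        = (\<integral>\<^sup>+t. indicator {0..<g y} t \<partial>lborel)"
      using that by (intro nn_integral_cong) (auto split: split_indicator)
    \<comment> \<open>For negative \<open>g y\<close> the interval is empty and
      \<open>ennreal\<close> truncates to 0.\<close>
    also have "\<dots> = ennreal (g y)"
      by (cases "0 \<le> g y") (auto simp: ennreal_neg)
    finally show ?thesis ..
  qed
  then have "(\<integral>\<^sup>+y. ennreal (g y) \<partial>M)
      = (\<integral>\<^sup>+y. (\<integral>\<^sup>+t. indicator {0..} t * indicator {y\<in>space M. t < g y} y \<partial>lborel) \<partial>M)"
    by (rule nn_integral_cong)
  also have "\<dots> = (\<integral>\<^sup>+t. (\<integral>\<^sup>+y. indicator {0..} t * indicator {y\<in>space M. t < g y} y \<partial>M) \<partial>lborel)"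
    by (rule Fubini') measurable
  also have "\<dots> = (\<integral>\<^sup>+t\<in>{0..}. emeasure M {y\<in>space M. t < g y} \<partial>lborel)"
    by (intro nn_integral_cong) (simp add: nn_integral_cmult level mult.commute)
  finally show "(\<integral>\<^sup>+y. ennreal (g y) \<partial>M)
      = (\<integral>\<^sup>+t\<in>{0..}. emeasure M {y\<in>space M. t < g y} \<partial>lborel)" .
qed

theorem lemma3p2:
  fixes h :: "real \<Rightarrow> real"
  assumes "mono_on {0<..1} h"
  shows "convex_on_ennreal (Simp :: (real ^ 'w) set) (phi h)"
proof -
  \<comment> \<open>\<open>h\<close> need not be measurable outside \<open>{0<..1}\<close>.\<close>
  define g where "g y = (if y \<in> {0<..1} then exp (- h y) else 0)" for y
  define S where "S t = {y. t < g y}" for t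
  have "(\<lambda>y. exp (- h y)) \<in> borel_measurable (restrict_space borel {0<..1})"
    using borel_measurable_mono_on_fnc[OF assms] by measurable
  then have g: "g \<in> borel_measurable borel"
    unfolding g_def by (subst measurable_If_restrict_space_iff) (simp_all only: Collect_mem_eq, auto)
  have gM: "g \<in> borel_measurable (gumbel_law P)" for P :: "real ^ 'w"
    using g by (simp add: gumbel_law_def cong: measurable_cong_sets)
  have space: "space (gumbel_law P) = UNIV" for P :: "real ^ 'w"
    by (simp add: gumbel_law_def)
  have sf: "sigma_finite_measure (gumbel_law P)" if "P \<in> Simp" for P :: "real ^ 'w"
  proof -
    interpret real_distribution "gumbel_law P"
      by (rule real_distribution_gumbel_law[OF that])
    show ?thesis ..
  qed
  have phi_eq: "phi h P = (\<integral>\<^sup>+t\<in>{0..}. emeasure (gumbel_law P) (S t) \<partial>lborel)"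
    if "P \<in> Simp" for P :: "real ^ 'w"
  proof -
    have "phi h P = (\<integral>\<^sup>+y. ennreal (g y) \<partial>gumbel_law P)"
      unfolding phi_def
      by (intro nn_integral_cong_AE eventually_mono[OF AE_gumbel_law[OF that]]) (simp add: g_def)
    then show ?thesis
      using nn_integral_layer_cake[OF sf[OF that] gM] by (simp add: S_def space)
  qed
  have S_meas [measurable]: "(\<lambda>t. emeasure (gumbel_law P) (S t)) \<in> borel_measurable borel"
    if "P \<in> Simp" for P :: "real ^ 'w"
    using borel_measurable_emeasure_superlevel[OF sf[OF that] gM] by (simp add: S_def space)
  have S_convex: "emeasure (gumbel_law (u *\<^sub>R P + v *\<^sub>R Q)) (S t)
      \<le> ennreal u * emeasure (gumbel_law P) (S t) + ennreal v * emeasure (gumbel_law Q) (S t)"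
    if PQ: "P \<in> Simp" "Q \<in> Simp" and uv: "0 \<le> u" "0 \<le> v" "u + v = 1" and "0 \<le> t"
    for P Q :: "real ^ 'w" and u v t
  \<comment> \<open>The empty level set is split off because its supremum carries no
    information.\<close>
  proof (cases "S t = {}")
    case False
    \<comment> \<open>Since \<open>g\<close> is 0 off \<open>{0<..1}\<close>, a level
      \<open>t\<close> that is at least 0 can only be exceeded inside this interval.\<close>
    have "S t \<in> sets borel" "S t \<subseteq> {0<..1}"
      using g \<open>0 \<le> t\<close> unfolding S_def by (measurable, auto simp: g_def split: if_splits)
    \<comment> \<open>Monotonicity of \<open>h\<close> enters here: \<open>g\<close> is
      non-increasing on \<open>{0<..1}\<close>.\<close>
    moreover have "y \<in> S t" if "x \<in> S t" "0 < y" "y \<le> x" for x y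
    proof -
      have "x \<le> 1"
        using \<open>x \<in> S t\<close> \<open>S t \<subseteq> {0<..1}\<close> by auto
      then have "g x \<le> g y"
        using that mono_onD[OF assms, of y x] by (simp add: g_def)
      with \<open>x \<in> S t\<close> show ?thesis
        by (simp add: S_def)
    qed
    ultimately have eq: "emeasure (gumbel_law R) (S t) = gumbel_cdf R (Sup (S t))"
      if "R \<in> Simp" for R :: "real ^ 'w"
      using False that by (intro emeasure_gumbel_law_initial_segment)
    have nonneg: "0 \<le> gumbel_cdf R r" if "R \<in> Simp" for R :: "real ^ 'w" and r
      using that by (auto simp: gumbel_cdf_clip Simp_def intro!: sum_nonneg)
    \<comment> \<open>All three measures are CDF values at the same point
      \<open>Sup (S t)\<close>.\<close>
    show ?thesis
      using gumbel_cdf_convex[OF PQ uv] nonneg PQ uv convexD[OF convex_Simp PQ uv]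
      by (simp add: eq ennreal_leI flip: ennreal_mult ennreal_plus)
  qed simp
  show ?thesis
    unfolding convex_on_ennreal_def
  proof (intro conjI ballI allI impI)
    fix P Q :: "real ^ 'w" and u v :: real
    assume PQ: "P \<in> Simp" "Q \<in> Simp" and uv: "0 \<le> u" "0 \<le> v" "u + v = 1"
    have [measurable]: "(\<lambda>t. emeasure (gumbel_law P) (S t)) \<in> borel_measurable borel"
      "(\<lambda>t. emeasure (gumbel_law Q) (S t)) \<in> borel_measurable borel"
      using PQ by (auto intro: S_meas)
    have "phi h (u *\<^sub>R P + v *\<^sub>R Q)
        = (\<integral>\<^sup>+t\<in>{0..}. emeasure (gumbel_law (u *\<^sub>R P + v *\<^sub>R Q)) (S t) \<partial>lborel)"
      using convexD[OF convex_Simp PQ uv] by (rule phi_eq)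
    \<comment> \<open>The indicator removes negative \<open>t\<close>, where \<open>S_convex\<close>
      says nothing.\<close>
    also have "\<dots> \<le> (\<integral>\<^sup>+t. ennreal u * (emeasure (gumbel_law P) (S t) * indicator {0..} t)
        + ennreal v * (emeasure (gumbel_law Q) (S t) * indicator {0..} t) \<partial>lborel)"
      using S_convex[OF PQ uv] by (intro nn_integral_mono) (auto split: split_indicator)
    also have "\<dots> = ennreal u * phi h P + ennreal v * phi h Q"
      using PQ by (simp add: nn_integral_add nn_integral_cmult phi_eq)
    finally show "phi h (u *\<^sub>R P + v *\<^sub>R Q) \<le> ennreal u * phi h P + ennreal v * phi h Q" .
  qed (rule convex_Simp)
qed

end
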